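(* Let $H$ be a set of functions that is closed under finite linear combinations. Let $\mathcal J^h:H\to\mathbb R$ be a finite-measurement loss, i.e. $\mathcal J^h(u)=G(\mathcal M(u))$ for all $u\in H$, with some $m\in\mathbb N$, a function $G:\mathbb R^m\to\mathbb R$ and a finite-measurement map $\mathcal M:H\to\mathbb R^m$, where $\mathcal M$ is linear. Assume that there exists a nonzero function $\Phi\in H$ such that $\mathcal M(\Phi)=0$. Then, for all $u\in H$ and all $\lambda\in\mathbb R$, $$\mathcal J^h(u+\lambda\Phi)=\mathcal J^h(u).$$ In particular, if $u$ is a minimizer of $\mathcal J^h$ on $H$, then $u+\lambda\Phi$ is also a minimizer for all $\lambda\in\mathbb R$, and the minimizer is not unique.
   Context: Functions are real-valued on a common domain and linear combinations have real coefficients. For a set of functions $H$ and $m\in\mathbb N$, any map $\mathcal M:H\to\mathbb R^m$ is called a finite-measurement map; a functional $\mathcal J^h:H\to\mathbb R$ is called a finite-measurement loss if there is $G:\mathbb R^m\to\mathbb R$ with $\mathcal J^h(u)=G(\mathcal M(u))$ for all $u\in H$. *)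

theory Defs
  imports Complex_Main "Jordan_Normal_Form.Matrix"
begin

text \<open>
  Functions are total functions \<open>'a \<Rightarrow> real\<close>, the type \<open>'a\<close> being the common domain; a domain that
  is a proper subset of a type is covered by extending functions by zero. Elements of
  $\mathbb{R}^m$ are the vectors in \<^term>\<open>carrier_vec m :: real vec set\<close>. Maps
  with domain $H$ are total functions of which only the values on \<open>H\<close> matter.
\<close>

definition closed_under_lincomb :: "('a \<Rightarrow> real) set \<Rightarrow> bool" where
  "closed_under_lincomb H \<longleftrightarrow>
     (\<forall>(n::nat) (c :: nat \<Rightarrow> real) (f :: nat \<Rightarrow> 'a \<Rightarrow> real).
        (\<forall>i<n. f i \<in> H) \<longrightarrow> (\<lambda>x. \<Sum>i<n. c i * f i x) \<in> H)"

definition finite_measurement_map ::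
    "('a \<Rightarrow> real) set \<Rightarrow> nat \<Rightarrow> (('a \<Rightarrow> real) \<Rightarrow> real vec) \<Rightarrow> bool" where
  "finite_measurement_map H m M \<longleftrightarrow> (\<forall>u\<in>H. M u \<in> carrier_vec m)"

definition finite_measurement_loss ::
    "('a \<Rightarrow> real) set \<Rightarrow> nat \<Rightarrow> (('a \<Rightarrow> real) \<Rightarrow> real vec) \<Rightarrow> (('a \<Rightarrow> real) \<Rightarrow> real) \<Rightarrow> bool" where
  "finite_measurement_loss H m M J \<longleftrightarrow>
     finite_measurement_map H m M \<and> (\<exists>G :: real vec \<Rightarrow> real. \<forall>u\<in>H. J u = G (M u))"

definition linear_map_on ::
    "('a \<Rightarrow> real) set \<Rightarrow> (('a \<Rightarrow> real) \<Rightarrow> real vec) \<Rightarrow> bool" where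
  "linear_map_on H M \<longleftrightarrow>
     (\<forall>u\<in>H. \<forall>v\<in>H. M (\<lambda>x. u x + v x) = M u + M v) \<and>
     (\<forall>c. \<forall>u\<in>H. M (\<lambda>x. c * u x) = c \<cdot>\<^sub>v M u)"

end

theory Submission
  imports Defs
begin

text \<open>
  A loss that sees \<open>u\<close> only through finitely many linear measurements cannot distinguish \<open>u\<close> from
  \<open>u + t \<Phi>\<close> when all measurements of \<open>\<Phi>\<close> vanish: by linearity both functions have the same
  measurement vector, hence the same loss. A minimizer \<open>u\<close> therefore comes with the whole line
  \<open>u + t \<Phi>\<close> of minimizers, and since \<open>\<Phi> \<noteq> 0\<close> the point \<open>t = 1\<close> of this line differs from \<open>u\<close>.
\<close>

lemma closed_under_lincomb_add_scaled:
  assumes H: "closed_under_lincomb H" and u: "u \<in> H" and v: "v \<in> H"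
  shows "(\<lambda>x. a * u x + b * v x) \<in> H"
proof -
  let ?c = "\<lambda>i::nat. if i = 0 then a else b"
  let ?f = "\<lambda>i::nat. if i = 0 then u else v"
  have "\<forall>i<2. ?f i \<in> H"
    using u v by simp
  then have "(\<lambda>x. \<Sum>i<(2::nat). ?c i * ?f i x) \<in> H"
    by (rule H[unfolded closed_under_lincomb_def, THEN spec[of _ 2], THEN spec[of _ ?c],
          THEN spec[of _ ?f], THEN mp])
  then show ?thesis
    by (simp add: numeral_2_eq_2)
qed

lemma measurement_add_kernel:
  assumes H: "closed_under_lincomb H"
    and M: "finite_measurement_map H m M" "linear_map_on H M"
    and \<Phi>: "\<Phi> \<in> H" "M \<Phi> = 0\<^sub>v m"
    and u: "u \<in> H"
  shows "M (\<lambda>x. u x + t * \<Phi> x) = M u"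
proof -
  have "(\<lambda>x. t * \<Phi> x) \<in> H"
    using closed_under_lincomb_add_scaled[OF H \<Phi>(1) \<Phi>(1), of t 0] by simp
  then have "M (\<lambda>x. u x + t * \<Phi> x) = M u + M (\<lambda>x. t * \<Phi> x)"
    using M(2) u unfolding linear_map_on_def by simp
  also have "M (\<lambda>x. t * \<Phi> x) = t \<cdot>\<^sub>v 0\<^sub>v m"
    using M(2) \<Phi> unfolding linear_map_on_def by metis
  also have "t \<cdot>\<^sub>v 0\<^sub>v m = 0\<^sub>v m"
    by (intro eq_vecI) auto
  \<comment> \<open>The zero vector carries its dimension, so it is neutral for \<open>M u\<close> only because \<open>M u\<close>
    has dimension \<open>m\<close>.\<close>
  also have "M u + 0\<^sub>v m = M u"
    using M(1) u unfolding finite_measurement_map_def by simp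
  finally show ?thesis .
qed

theorem lemma2p1:
  fixes H :: "('a \<Rightarrow> real) set"
    and m :: nat
    and M :: "('a \<Rightarrow> real) \<Rightarrow> real vec"
    and J :: "('a \<Rightarrow> real) \<Rightarrow> real"
    and \<Phi> :: "'a \<Rightarrow> real"
  assumes "closed_under_lincomb H"
    and "finite_measurement_loss H m M J"
    and "linear_map_on H M"
    and "\<Phi> \<in> H"
    and "\<Phi> \<noteq> (\<lambda>x. 0)"
    and "M \<Phi> = 0\<^sub>v m"
  shows "(\<forall>u\<in>H. \<forall>t::real. J (\<lambda>x. u x + t * \<Phi> x) = J u) \<and>
         (\<forall>u. is_arg_min J (\<lambda>v. v \<in> H) u \<longrightarrow>
            (\<forall>t::real. is_arg_min J (\<lambda>v. v \<in> H) (\<lambda>x. u x + t * \<Phi> x)) \<and>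
            \<not> (\<exists>!w. is_arg_min J (\<lambda>v. v \<in> H) w))"
proof -
  obtain G where M: "finite_measurement_map H m M" and G: "\<And>u. u \<in> H \<Longrightarrow> J u = G (M u)"
    using assms(2) unfolding finite_measurement_loss_def by blast
  have line: "(\<lambda>x. u x + t * \<Phi> x) \<in> H" if "u \<in> H" for u t
    using closed_under_lincomb_add_scaled[OF assms(1) that assms(4), of 1 t] by simp
  have invariant: "J (\<lambda>x. u x + t * \<Phi> x) = J u" if "u \<in> H" for u t
    using measurement_add_kernel[OF assms(1) M assms(3,4,6) that] G line that by simp
  have minimizers: "is_arg_min J (\<lambda>v. v \<in> H) (\<lambda>x. u x + t * \<Phi> x)"
    if "is_arg_min J (\<lambda>v. v \<in> H) u" for u t
    using that line invariant by (simp add: is_arg_min_def)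
  have not_unique: "\<not> (\<exists>!w. is_arg_min J (\<lambda>v. v \<in> H) w)"
    if u: "is_arg_min J (\<lambda>v. v \<in> H) u" for u
  proof
    assume "\<exists>!w. is_arg_min J (\<lambda>v. v \<in> H) w"
    then have eq: "(\<lambda>x. u x + 1 * \<Phi> x) = u"
      using u minimizers[OF u, of 1] by blast
    have "\<Phi> x = 0" for x
      using fun_cong[OF eq, of x] by simp
    then show False
      using assms(5) by blast
  qed
  show ?thesis
    using invariant minimizers not_unique by blast
qed

end
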